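(* Let $n\ge 2$ and let $G$ be the caterpillar graph obtained from the path (spine) $P_n=v_1v_2\cdots v_n$ by attaching $l_i\ge 1$ leaves $v_{i_1},\dots,v_{i_{l_i}}$ to $v_i$ for each $i=1,\dots,n$. Let $f$ be an admissible function on $G$ with $f(v_i)=k_i$ for $1\le i\le n$ and $f(v_{i_j})=1$ for every leaf $v_{i_j}$ ($1\le j\le l_i$, $1\le i\le n$). Suppose that for every $i=1,\dots,n$ we have $l_i>0$ and $k_i>1$, and that $k_i=3$ whenever $l_i=1$. Then $$\gamma_{\overline{f}}(G)=\sum_{i\in\{1,n\}}\left(l_i-\left\lceil\frac{l_i+1}{k_i}\right\rceil\right)+\sum_{i=2}^{n-1}\left(l_i-\left\lceil\frac{l_i+2}{k_i}\right\rceil\right)+n .$$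
   Context: All graphs $G=(V,E)$ are finite and simple, and $d_G(v)$ denotes the degree of a vertex $v$. An admissible function is a function $f:V\to\mathbb{N}$ such that $1\le f(v)\le d_G(v)$ for every non-isolated vertex $v$, and $f(v)=1$ if $v$ is isolated. A set $D\subseteq V$ is a ceil degree restricted dominating set (CDRD-set) if each vertex of $V\setminus D$ can be assigned to a vertex of $D$ adjacent to it (which is said to dominate it) in such a way that each $v\in D$ has at most $\lceil d_G(v)/f(v)\rceil$ vertices of $V\setminus D$ assigned to it. The minimum cardinality of a CDRD-set of $G$ is denoted $\gamma_{\overline{f}}(G)$. In the caterpillar, the spine vertex $v_i$ has degree $l_i+1$ if $i\in\{1,n\}$ and $l_i+2$ if $2\le i\le n-1$. *)

theory Defs
  imports Complex_Main
begin

text \<open>Graphs are given by a vertex set and a set of edges, an edge being the set of its two ends.\<close>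

definition simple_graph :: "'a set \<Rightarrow> 'a set set \<Rightarrow> bool" where
  "simple_graph V E \<longleftrightarrow> finite V \<and> (\<forall>e\<in>E. e \<subseteq> V \<and> card e = 2)"

definition degree :: "'a set \<Rightarrow> 'a set set \<Rightarrow> 'a \<Rightarrow> nat" where
  "degree V E v = card {u \<in> V. {u, v} \<in> E}"

definition admissible :: "'a set \<Rightarrow> 'a set set \<Rightarrow> ('a \<Rightarrow> nat) \<Rightarrow> bool" where
  "admissible V E f \<longleftrightarrow>
     (\<forall>v\<in>V. if degree V E v = 0 then f v = 1 else 1 \<le> f v \<and> f v \<le> degree V E v)"

text \<open>The function \<open>\<phi>\<close> assigns to each vertex outside \<open>D\<close> the vertex that dominates it.\<close>

definition cdrd_set :: "'a set \<Rightarrow> 'a set set \<Rightarrow> ('a \<Rightarrow> nat) \<Rightarrow> 'a set \<Rightarrow> bool" where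
  "cdrd_set V E f D \<longleftrightarrow> D \<subseteq> V \<and>
     (\<exists>\<phi>. (\<forall>u\<in>V - D. \<phi> u \<in> D \<and> {u, \<phi> u} \<in> E) \<and>
          (\<forall>v\<in>D. int (card {u \<in> V - D. \<phi> u = v}) \<le> \<lceil>real (degree V E v) / real (f v)\<rceil>))"

definition cdrd_number :: "'a set \<Rightarrow> 'a set set \<Rightarrow> ('a \<Rightarrow> nat) \<Rightarrow> nat" where
  "cdrd_number V E f = (LEAST m. \<exists>D. cdrd_set V E f D \<and> card D = m)"

text \<open>The graph \<open>(V, E)\<close> is the caterpillar with spine \<open>v 1, \<dots>, v n\<close> and leaves
  \<open>w i 1, \<dots>, w i (l i)\<close> attached to \<open>v i\<close>. The first three conditions say that all these
  vertices are pairwise distinct. Only the values of \<open>v\<close>, \<open>w\<close> and \<open>l\<close> at indices in range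
  matter.\<close>

definition caterpillar ::
  "nat \<Rightarrow> (nat \<Rightarrow> nat) \<Rightarrow> (nat \<Rightarrow> 'a) \<Rightarrow> (nat \<Rightarrow> nat \<Rightarrow> 'a) \<Rightarrow> 'a set \<Rightarrow> 'a set set \<Rightarrow> bool" where
  "caterpillar n l v w V E \<longleftrightarrow>
     inj_on v {1..n} \<and>
     inj_on (\<lambda>(i, j). w i j) (SIGMA i:{1..n}. {1..l i}) \<and>
     (\<forall>h\<in>{1..n}. \<forall>i\<in>{1..n}. \<forall>j\<in>{1..l i}. v h \<noteq> w i j) \<and>
     V = {v i | i. i \<in> {1..n}} \<union> {w i j | i j. i \<in> {1..n} \<and> j \<in> {1..l i}} \<and>
     E = {{v i, v (i + 1)} | i. i \<in> {1..<n}} \<union>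
         {{v i, w i j} | i j. i \<in> {1..n} \<and> j \<in> {1..l i}}"

lemma caterpillar_simple_graph:
  assumes "caterpillar n l v w V E"
  shows "simple_graph V E"
proof -
  have inj: "inj_on v {1..n}"
    and sep: "\<forall>h\<in>{1..n}. \<forall>i\<in>{1..n}. \<forall>j\<in>{1..l i}. v h \<noteq> w i j"
    and V: "V = {v i | i. i \<in> {1..n}} \<union> {w i j | i j. i \<in> {1..n} \<and> j \<in> {1..l i}}"
    and E: "E = {{v i, v (i + 1)} | i. i \<in> {1..<n}} \<union>
         {{v i, w i j} | i j. i \<in> {1..n} \<and> j \<in> {1..l i}}"
    using assms unfolding caterpillar_def by blast+
  have V': "V = v ` {1..n} \<union> (\<lambda>(i, j). w i j) ` (SIGMA i:{1..n}. {1..l i})"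
    unfolding V by force
  have "finite V"
    unfolding V' by (intro finite_UnI finite_imageI finite_SigmaI) auto
  moreover have "e \<subseteq> V \<and> card e = 2" if e: "e \<in> E" for e
  proof -
    consider (spine) i where "i \<in> {1..<n}" "e = {v i, v (i + 1)}"
      | (leaf) i j where "i \<in> {1..n}" "j \<in> {1..l i}" "e = {v i, w i j}"
      using e unfolding E by blast
    then show ?thesis
    proof cases
      case spine
      have "i \<in> {1..n}" "i + 1 \<in> {1..n}" using spine(1) by auto
      moreover from this have "v i \<noteq> v (i + 1)" using inj_onD[OF inj, of i "i + 1"] by auto
      ultimately show ?thesis using spine(2) unfolding V by (auto simp: card_2_iff)
    next
      case leaf
      then have "v i \<noteq> w i j" using sep by blast
      then show ?thesis using leaf unfolding V by (auto simp: card_2_iff)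
    qed
  qed
  ultimately show ?thesis unfolding simple_graph_def by blast
qed

end

theory Submission
  imports Defs
begin

text \<open>Every vertex outside a CDRD-set \<open>D\<close> is charged to the index \<open>i\<close> of the star (spine vertex
  \<open>v i\<close> with its leaves) containing its dominator. If \<open>v i \<in> D\<close>, the leaves of that star dominate
  nothing, so at most \<open>c i = \<lceil>degree (v i) / k i\<rceil>\<close> vertices are charged to \<open>i\<close>; otherwise only
  \<open>v i\<close> itself can be, and \<open>1 \<le> c i\<close>. Hence at most \<open>\<Sum>i. c i\<close> vertices lie outside \<open>D\<close>. The
  hypotheses on \<open>l i\<close> and \<open>k i\<close> give \<open>c i \<le> l i\<close>, so that equality is attained by letting each
  \<open>v i\<close> dominate \<open>c i\<close> of its own leaves.\<close>

section \<open>Adjacency, degrees and counting in a caterpillar\<close>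

lemma caterpillar_leaf_edge:
  assumes "caterpillar n l v w V E" "i \<in> {1..n}" "j \<in> {1..l i}" "{w i j, x} \<in> E"
  shows "x = v i"
proof -
  have inj: "inj_on (\<lambda>(i, j). w i j) (SIGMA i:{1..n}. {1..l i})"
    and sep: "\<And>h i j. h \<in> {1..n} \<Longrightarrow> i \<in> {1..n} \<Longrightarrow> j \<in> {1..l i} \<Longrightarrow> v h \<noteq> w i j"
    and E: "E = {{v i, v (i + 1)} | i. i \<in> {1..<n}} \<union>
         {{v i, w i j} | i j. i \<in> {1..n} \<and> j \<in> {1..l i}}"
    using assms(1) unfolding caterpillar_def by blast+
  consider (spine) h where "h \<in> {1..<n}" "{w i j, x} = {v h, v (h + 1)}"
    | (leaf) h m where "h \<in> {1..n}" "m \<in> {1..l h}" "{w i j, x} = {v h, w h m}"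
    using assms(4) unfolding E by blast
  then show ?thesis
  proof cases
    case spine
    then have "h \<in> {1..n}" "h + 1 \<in> {1..n}" by auto
    then show ?thesis using sep assms(2,3) spine(2) by (metis doubleton_eq_iff)
  next
    case leaf
    then have "w i j = w h m" "x = v h"
      using sep[OF leaf(1) assms(2,3)] by (auto simp: doubleton_eq_iff)
    moreover from this have "(i, j) = (h, m)"
      using inj_onD[OF inj, of "(i, j)" "(h, m)"] leaf(1,2) assms(2,3) by auto
    ultimately show ?thesis by simp
  qed
qed

text \<open>Intersecting with \<open>{1..n}\<close> treats ends and interior of the spine alike: the
  would-be neighbours \<open>v 0\<close> and \<open>v (n + 1)\<close> drop out.\<close>

lemma caterpillar_degree_spine:
  assumes "caterpillar n l v w V E" "i \<in> {1..n}"
  shows "degree V E (v i) = l i + card ({i - 1, i + 1} \<inter> {1..n})"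
proof -
  have injv: "inj_on v {1..n}"
    and inj: "inj_on (\<lambda>(i, j). w i j) (SIGMA i:{1..n}. {1..l i})"
    and sep: "\<And>h i j. h \<in> {1..n} \<Longrightarrow> i \<in> {1..n} \<Longrightarrow> j \<in> {1..l i} \<Longrightarrow> v h \<noteq> w i j"
    and V: "V = {v i | i. i \<in> {1..n}} \<union> {w i j | i j. i \<in> {1..n} \<and> j \<in> {1..l i}}"
    and E: "E = {{v i, v (i + 1)} | i. i \<in> {1..<n}} \<union>
         {{v i, w i j} | i j. i \<in> {1..n} \<and> j \<in> {1..l i}}"
    using assms(1) unfolding caterpillar_def by blast+
  let ?N = "{i - 1, i + 1} \<inter> {1..n}"
  have "{u \<in> V. {u, v i} \<in> E} = w i ` {1..l i} \<union> v ` ?N"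
  proof (intro equalityI subsetI)
    fix u assume "u \<in> {u \<in> V. {u, v i} \<in> E}"
    then have u: "{u, v i} \<in> E" by blast
    then consider (spine) h where "h \<in> {1..<n}" "{u, v i} = {v h, v (h + 1)}"
      | (leaf) h m where "h \<in> {1..n}" "m \<in> {1..l h}" "{u, v i} = {v h, w h m}"
      unfolding E by blast
    then show "u \<in> w i ` {1..l i} \<union> v ` ?N"
    proof cases
      case spine
      then have h: "h \<in> {1..n}" "h + 1 \<in> {1..n}" by auto
      from spine(2) consider "u = v h" "v i = v (h + 1)" | "u = v (h + 1)" "v i = v h"
        by (auto simp: doubleton_eq_iff)
      then show ?thesis
      proof cases
        case 1
        then have "i = h + 1" using inj_onD[OF injv _ assms(2) h(2)] by blast
        then show ?thesis using 1 h by auto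
      next
        case 2
        then have "i = h" using inj_onD[OF injv _ assms(2) h(1)] by blast
        then show ?thesis using 2 h by auto
      qed
    next
      case leaf
      then have "u = w h m" "v i = v h"
        using sep[OF assms(2) leaf(1,2)] by (auto simp: doubleton_eq_iff)
      moreover from this have "i = h" using inj_onD[OF injv _ assms(2) leaf(1)] by blast
      ultimately show ?thesis using leaf(2) by auto
    qed
  next
    fix u assume "u \<in> w i ` {1..l i} \<union> v ` ?N"
    then consider (leaf) j where "j \<in> {1..l i}" "u = w i j"
      | (prev) "u = v (i - 1)" "i - 1 \<in> {1..n}"
      | (succ) "u = v (i + 1)" "i + 1 \<in> {1..n}" by blast
    then show "u \<in> {u \<in> V. {u, v i} \<in> E}"
    proof cases
      case leaf
      then show ?thesis using assms(2) unfolding V E by (auto simp: insert_commute)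
    next
      case prev
      \<comment> \<open>Writing \<open>i\<close> as a successor brings the edge to the form
        \<open>{v h, v (h + 1)}\<close> used in \<open>E\<close>.\<close>
      then obtain h where h: "i = h + 1" "h \<in> {1..<n}" using assms(2) by (cases i) auto
      then have "{u, v i} \<in> E" using prev(1) unfolding E by auto
      then show ?thesis using prev unfolding V by blast
    next
      case succ
      then have "i \<in> {1..<n}" using assms(2) by auto
      then have "{u, v i} \<in> E" using succ(1) unfolding E by (auto simp: insert_commute)
      then show ?thesis using succ unfolding V by blast
    qed
  qed
  moreover have "card (w i ` {1..l i}) = l i"
  proof -
    have "inj_on (w i) {1..l i}"
    proof (rule inj_onI)
      fix a b assume "a \<in> {1..l i}" "b \<in> {1..l i}" "w i a = w i b"
      then show "a = b" using inj_onD[OF inj, of "(i, a)" "(i, b)"] assms(2) by auto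
    qed
    then show ?thesis by (simp add: card_image)
  qed
  moreover have "card (v ` ?N) = card ?N"
    by (rule card_image) (rule inj_on_subset[OF injv], simp)
  moreover have "w i ` {1..l i} \<inter> v ` ?N = {}" using sep[OF _ assms(2)] by fastforce
  ultimately show ?thesis unfolding degree_def by (simp add: card_Un_disjoint)
qed

text \<open>The sets \<open>J i\<close> of selected leaves are left open because two cases occur:
  all leaves, which counts \<open>V\<close>, and the leaves kept in a smallest CDRD-set.\<close>

lemma caterpillar_card:
  assumes "caterpillar n l v w V E"
    and "\<And>i. i \<in> {1..n} \<Longrightarrow> J i \<subseteq> {1..l i}"
  shows "card (v ` {1..n} \<union> (\<lambda>(i, j). w i j) ` (SIGMA i:{1..n}. J i)) = n + (\<Sum>i = 1..n. card (J i))"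
proof -
  let ?W = "(\<lambda>(i, j). w i j) ` (SIGMA i:{1..n}. J i)"
  have injv: "inj_on v {1..n}"
    and inj: "inj_on (\<lambda>(i, j). w i j) (SIGMA i:{1..n}. {1..l i})"
    and sep: "\<And>h i j. h \<in> {1..n} \<Longrightarrow> i \<in> {1..n} \<Longrightarrow> j \<in> {1..l i} \<Longrightarrow> v h \<noteq> w i j"
    using assms(1) unfolding caterpillar_def by blast+
  have sub: "(SIGMA i:{1..n}. J i) \<subseteq> (SIGMA i:{1..n}. {1..l i})" using assms(2) by fast
  have fin: "\<And>i. i \<in> {1..n} \<Longrightarrow> finite (J i)" using assms(2) finite_subset by blast
  have "card ?W = (\<Sum>i = 1..n. card (J i))"
    using card_image[OF inj_on_subset[OF inj sub]] fin by simp
  moreover have "v ` {1..n} \<inter> ?W = {}" using sep assms(2) by fast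
  moreover have "finite ?W" using fin by blast
  moreover have "card (v ` {1..n}) = n" using card_image[OF injv] by simp
  ultimately show ?thesis by (simp add: card_Un_disjoint)
qed

lemma caterpillar_vertices:
  assumes "caterpillar n l v w V E"
  shows "V = v ` {1..n} \<union> (\<lambda>(i, j). w i j) ` (SIGMA i:{1..n}. {1..l i})"
  using assms unfolding caterpillar_def by force

lemma caterpillar_vertex_cases:
  assumes "caterpillar n l v w V E" "u \<in> V"
  obtains (spine) i where "i \<in> {1..n}" "u = v i"
    | (leaf) i j where "i \<in> {1..n}" "j \<in> {1..l i}" "u = w i j"
  using assms unfolding caterpillar_def by blast

section \<open>Lower bound for every CDRD-set\<close>

lemma caterpillar_cdrd_set_lower:
  assumes cat: "caterpillar n l v w V E" and D: "cdrd_set V E f D"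
    and c: "\<And>i. i \<in> {1..n} \<Longrightarrow> \<lceil>real (degree V E (v i)) / real (f (v i))\<rceil> \<le> int (c i)"
    and c_pos: "\<And>i. i \<in> {1..n} \<Longrightarrow> 1 \<le> c i"
  shows "n + (\<Sum>i = 1..n. l i) \<le> card D + (\<Sum>i = 1..n. c i)"
proof -
  note V = caterpillar_vertices[OF cat]
  have finV: "finite V" using caterpillar_simple_graph[OF cat] unfolding simple_graph_def by blast
  obtain \<phi> where DV: "D \<subseteq> V" and \<phi>: "\<And>u. u \<in> V - D \<Longrightarrow> \<phi> u \<in> D \<and> {u, \<phi> u} \<in> E"
    and cap: "\<And>x. x \<in> D \<Longrightarrow>
      int (card {u \<in> V - D. \<phi> u = x}) \<le> \<lceil>real (degree V E x) / real (f x)\<rceil>"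
    using D unfolding cdrd_set_def by blast
  \<comment> \<open>\<open>F i\<close> holds the vertices charged to star \<open>i\<close>. They
    need not lie in that star, since \<open>v i\<close> may dominate its neighbours on the
    spine.\<close>
  define F where "F i = {u \<in> V - D. \<phi> u = v i \<or> (\<exists>j\<in>{1..l i}. \<phi> u = w i j)}" for i
  have leaf: "u = v i" if "u \<in> V - D" "i \<in> {1..n}" "j \<in> {1..l i}" "\<phi> u = w i j" for u i j
    using caterpillar_leaf_edge[OF cat that(2,3), of u] \<phi>[OF that(1)] that(4)
    by (simp add: insert_commute)
  have F: "card (F i) \<le> c i" if i: "i \<in> {1..n}" for i
  proof (cases "v i \<in> D")
    case True
    \<comment> \<open>A leaf of star \<open>i\<close> could only dominate \<open>v i\<close>, which
      lies in \<open>D\<close> here, so the capacity of \<open>v i\<close> bounds the whole of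
      \<open>F i\<close>.\<close>
    have "F i = {u \<in> V - D. \<phi> u = v i}" using leaf[OF _ i] True unfolding F_def by blast
    then show ?thesis using cap[OF True] c[OF i] by simp
  next
    case False
    have "F i \<subseteq> {v i}" using leaf[OF _ i] \<phi> False unfolding F_def by fastforce
    then have "card (F i) \<le> 1" using card_mono[of "{v i}" "F i"] by simp
    then show ?thesis using c_pos[OF i] by simp
  qed
  have "V - D \<subseteq> (\<Union>i\<in>{1..n}. F i)"
  proof
    fix u assume u: "u \<in> V - D"
    then have "\<phi> u \<in> V" using \<phi> DV by blast
    then obtain i where "i \<in> {1..n}" "\<phi> u = v i \<or> (\<exists>j\<in>{1..l i}. \<phi> u = w i j)"
      using caterpillar_vertex_cases[OF cat] by metis
    then show "u \<in> (\<Union>i\<in>{1..n}. F i)" using u unfolding F_def by blast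
  qed
  moreover have "finite (\<Union>i\<in>{1..n}. F i)" using finV unfolding F_def by simp
  ultimately have "card (V - D) \<le> card (\<Union>i\<in>{1..n}. F i)" by (rule card_mono[rotated])
  also have "\<dots> \<le> (\<Sum>i = 1..n. card (F i))" by (rule card_UN_le) simp
  also have "\<dots> \<le> (\<Sum>i = 1..n. c i)" using F by (rule sum_mono)
  finally have "card (V - D) \<le> (\<Sum>i = 1..n. c i)" .
  moreover have "card (V - D) = card V - card D"
    using DV finV finite_subset by (intro card_Diff_subset) auto
  moreover have "card V = n + (\<Sum>i = 1..n. l i)"
    using caterpillar_card[OF cat, of "\<lambda>i. {1..l i}"] V by simp
  ultimately show ?thesis by simp
qed

section \<open>A CDRD-set attaining the bound\<close>

lemma caterpillar_cdrd_set_exists: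
  assumes cat: "caterpillar n l v w V E"
    and c: "\<And>i. i \<in> {1..n} \<Longrightarrow> int (c i) \<le> \<lceil>real (degree V E (v i)) / real (f (v i))\<rceil>"
    and cl: "\<And>i. i \<in> {1..n} \<Longrightarrow> c i \<le> l i"
  obtains D where "cdrd_set V E f D" "card D = n + (\<Sum>i = 1..n. l i - c i)"
proof -
  have inj: "inj_on (\<lambda>(i, j). w i j) (SIGMA i:{1..n}. {1..l i})"
    and injv: "inj_on v {1..n}"
    and E: "E = {{v i, v (i + 1)} | i. i \<in> {1..<n}} \<union>
         {{v i, w i j} | i j. i \<in> {1..n} \<and> j \<in> {1..l i}}"
    using cat unfolding caterpillar_def by blast+
  note V = caterpillar_vertices[OF cat]
  let ?S = "SIGMA i:{1..n}. {1..l i}" and ?g = "\<lambda>(i, j). w i j"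
  \<comment> \<open>The whole spine is kept, and the first \<open>c i\<close> leaves of each star
    are left out.\<close>
  define D where "D = v ` {1..n} \<union> ?g ` (SIGMA i:{1..n}. {c i + 1..l i})"
  \<comment> \<open>Inverting the labelling of the leaves recovers the star of a leaf, so each leaf
    is sent to its own spine vertex. The values on the spine are immaterial, as the spine lies in
    \<open>D\<close>.\<close>
  define \<phi> where "\<phi> u = v (fst (inv_into ?S ?g u))" for u
  have \<phi>: "\<phi> (w i j) = v i" if "i \<in> {1..n}" "j \<in> {1..l i}" for i j
    using inv_into_f_f[OF inj, of "(i, j)"] that unfolding \<phi>_def by simp
  \<comment> \<open>The range \<open>{1..c i}\<close> serves the counting, the range
    \<open>{1..l i}\<close> the evaluation of \<open>\<phi>\<close>.\<close>
  have out: "\<exists>i j. i \<in> {1..n} \<and> j \<in> {1..c i} \<and> j \<in> {1..l i} \<and> u = w i j" if "u \<in> V - D" for u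
  proof -
    have "u \<in> V" "u \<notin> v ` {1..n}" using that unfolding D_def by auto
    then obtain i j where ij: "i \<in> {1..n}" "j \<in> {1..l i}" "u = w i j"
      using caterpillar_vertex_cases[OF cat] by blast
    have "j \<notin> {c i + 1..l i}" using ij(1,3) that unfolding D_def by force
    then have "j \<in> {1..c i}" using ij(2) by auto
    then show ?thesis using ij by blast
  qed
  have "D \<subseteq> V" unfolding V D_def by (intro Un_mono image_mono Sigma_mono) auto
  moreover have "\<phi> u \<in> D \<and> {u, \<phi> u} \<in> E" if u: "u \<in> V - D" for u
  proof -
    obtain i j where ij: "i \<in> {1..n}" "j \<in> {1..l i}" "u = w i j" using out[OF u] by blast
    then have "\<phi> u = v i" using \<phi> by blast
    then show ?thesis using ij unfolding D_def E by (auto simp: insert_commute)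
  qed
  moreover have "int (card {u \<in> V - D. \<phi> u = x}) \<le> \<lceil>real (degree V E x) / real (f x)\<rceil>" for x
  proof (cases "x \<in> v ` {1..n}")
    case True
    then obtain i where i: "i \<in> {1..n}" "x = v i" by blast
    have "{u \<in> V - D. \<phi> u = x} \<subseteq> w i ` {1..c i}"
    proof
      fix u assume u: "u \<in> {u \<in> V - D. \<phi> u = x}"
      then obtain h j where hj: "h \<in> {1..n}" "j \<in> {1..c h}" "j \<in> {1..l h}" "u = w h j"
        using out by blast
      then have "v h = v i" using \<phi> u i(2) by auto
      then have "h = i" using inj_onD[OF injv _ hj(1) i(1)] by blast
      then show "u \<in> w i ` {1..c i}" using hj by blast
    qed
    then have "card {u \<in> V - D. \<phi> u = x} \<le> c i"
      using surj_card_le[of "{1..c i}" _ "w i"] by simp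
    then show ?thesis using c[OF i(1)] unfolding i(2) by linarith
  next
    case False
    \<comment> \<open>Only spine vertices dominate, so any other \<open>x\<close> has nothing
      assigned to it and a nonnegative capacity suffices.\<close>
    have "\<phi> u \<in> v ` {1..n}" if "u \<in> V - D" for u using out[OF that] \<phi> by blast
    then have "{u \<in> V - D. \<phi> u = x} = {}" using False by blast
    then have "card {u \<in> V - D. \<phi> u = x} = 0" by (metis card.empty)
    moreover have "0 \<le> real (degree V E x) / real (f x)" by simp
    ultimately show ?thesis by linarith
  qed
  ultimately have "cdrd_set V E f D" unfolding cdrd_set_def by blast
  moreover have "card D = n + (\<Sum>i = 1..n. l i - c i)"
    unfolding D_def by (subst caterpillar_card[OF cat]) auto
  ultimately show thesis using that by blast
qed

section \<open>Capacities of the spine vertices and the exact value\<close>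

theorem theorem2p11:
  fixes n :: nat and l k :: "nat \<Rightarrow> nat"
    and v :: "nat \<Rightarrow> 'a" and w :: "nat \<Rightarrow> nat \<Rightarrow> 'a"
    and V :: "'a set" and E :: "'a set set" and f :: "'a \<Rightarrow> nat"
  assumes "n \<ge> 2"
    and "caterpillar n l v w V E"
    and "admissible V E f"
    and "\<And>i. i \<in> {1..n} \<Longrightarrow> f (v i) = k i"
    and "\<And>i j. i \<in> {1..n} \<Longrightarrow> j \<in> {1..l i} \<Longrightarrow> f (w i j) = 1"
    and "\<And>i. i \<in> {1..n} \<Longrightarrow> l i > 0"
    and "\<And>i. i \<in> {1..n} \<Longrightarrow> k i > 1"
    and "\<And>i. i \<in> {1..n} \<Longrightarrow> l i = 1 \<Longrightarrow> k i = 3"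
  shows "int (cdrd_number V E f) =
      (\<Sum>i\<in>{1, n}. int (l i) - \<lceil>(real (l i) + 1) / real (k i)\<rceil>)
    + (\<Sum>i = 2..n - 1. int (l i) - \<lceil>(real (l i) + 2) / real (k i)\<rceil>)
    + int n"
proof -
  note cat = assms(2)
  define c where "c i = nat \<lceil>real (degree V E (v i)) / real (k i)\<rceil>" for i
  have deg_end: "degree V E (v i) = l i + 1" if "i \<in> {1, n}" for i
  proof -
    \<comment> \<open>Since \<open>n \<ge> 2\<close>, each end of the spine has exactly one
      neighbour on it.\<close>
    have "{i - 1, i + 1} \<inter> {1..n} = {if i = 1 then 2 else n - 1}" using that assms(1) by auto
    then show ?thesis using caterpillar_degree_spine[OF cat, of i] that assms(1) by auto
  qed
  have deg_mid: "degree V E (v i) = l i + 2" if "i \<in> {2..n - 1}" for i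
  proof -
    have "{i - 1, i + 1} \<inter> {1..n} = {i - 1, i + 1}" using that by auto
    then show ?thesis using caterpillar_degree_spine[OF cat, of i] that by auto
  qed
  \<comment> \<open>For \<open>n = 2\<close> the interior range is empty.\<close>
  have range: "{1..n} = {1, n} \<union> {2..n - 1}" "{1, n} \<inter> {2..n - 1} = {}" using assms(1) by auto
  have k_le: "k i \<le> degree V E (v i)" if i: "i \<in> {1..n}" for i
  proof -
    have "v i \<in> V" using caterpillar_vertices[OF cat] i by blast
    moreover have "degree V E (v i) \<noteq> 0"
      using deg_end[of i] deg_mid[of i] i range(1)
      by (metis Un_iff add_eq_0_iff_both_eq_0 zero_neq_numeral zero_neq_one)
    ultimately show ?thesis using assms(3,4) i unfolding admissible_def by fastforce
  qed
  have c_pos: "1 \<le> c i" if i: "i \<in> {1..n}" for i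
  proof -
    have "0 < real (degree V E (v i)) / real (k i)" using k_le[OF i] assms(7)[OF i] by simp
    then show ?thesis unfolding c_def by linarith
  qed
  have int_c: "int (c i) = \<lceil>real (degree V E (v i)) / real (k i)\<rceil>" if "i \<in> {1..n}" for i
    using c_pos[OF that] unfolding c_def by linarith
  have cl: "c i \<le> l i" if i: "i \<in> {1..n}" for i
  proof -
    have d: "degree V E (v i) \<le> l i + 2" using deg_end[of i] deg_mid[of i] i range(1) by fastforce
    \<comment> \<open>This is \<open>c i \<le> l i\<close> with the ceiling and the division
      cleared. For \<open>l i = 1\<close> the degree is at most 3, which is \<open>k i\<close>;
      otherwise \<open>l i + 2 \<le> 2 * l i \<le> k i * l i\<close>.\<close>
    have "degree V E (v i) \<le> l i * k i"
    proof (cases "l i = 1")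
      case True
      then show ?thesis using d assms(8)[OF i] by simp
    next
      case False
      then have "2 \<le> l i" "2 \<le> k i" using assms(6,7)[OF i] by auto
      then have "l i * 2 \<le> l i * k i" by simp
      then show ?thesis using d \<open>2 \<le> l i\<close> by linarith
    qed
    then have "real (degree V E (v i)) \<le> real (l i) * real (k i)" by (metis of_nat_le_iff of_nat_mult)
    then have "real (degree V E (v i)) / real (k i) \<le> real (l i)"
      using assms(7)[OF i] by (simp add: divide_le_eq)
    then have "\<lceil>real (degree V E (v i)) / real (k i)\<rceil> \<le> int (l i)" by (simp add: ceiling_le_iff)
    then show ?thesis using int_c[OF i] by linarith
  qed
  have c_f: "\<lceil>real (degree V E (v i)) / real (f (v i))\<rceil> = int (c i)" if "i \<in> {1..n}" for i
    using int_c assms(4) that by simp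
  obtain D where D: "cdrd_set V E f D" "card D = n + (\<Sum>i = 1..n. l i - c i)"
    using caterpillar_cdrd_set_exists[OF cat, of c f] c_f cl by auto
  have "cdrd_number V E f = n + (\<Sum>i = 1..n. l i - c i)"
    unfolding cdrd_number_def
  proof (rule Least_equality)
    show "\<exists>D. cdrd_set V E f D \<and> card D = n + (\<Sum>i = 1..n. l i - c i)" using D by blast
  next
    fix m assume "\<exists>D. cdrd_set V E f D \<and> card D = m"
    then have "n + (\<Sum>i = 1..n. l i) \<le> m + (\<Sum>i = 1..n. c i)"
      using caterpillar_cdrd_set_lower[OF cat, of f _ c] c_f c_pos by auto
    \<comment> \<open>By \<open>c i \<le> l i\<close> no subtraction of naturals is truncated,
      neither termwise nor in total.\<close>
    moreover have "(\<Sum>i = 1..n. l i - c i) = (\<Sum>i = 1..n. l i) - (\<Sum>i = 1..n. c i)"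
      using cl by (intro sum_subtractf_nat)
    moreover have "(\<Sum>i = 1..n. c i) \<le> (\<Sum>i = 1..n. l i)" using cl by (rule sum_mono)
    ultimately show "n + (\<Sum>i = 1..n. l i - c i) \<le> m" by linarith
  qed
  moreover have "int (\<Sum>i = 1..n. l i - c i) = (\<Sum>i = 1..n. int (l i) - int (c i))"
    using cl by (simp add: of_nat_diff)
  \<comment> \<open>Ends and interior are separated because the degree is \<open>l i + 1\<close> on
    the former and \<open>l i + 2\<close> on the latter.\<close>
  moreover have "\<dots> = (\<Sum>i\<in>{1, n}. int (l i) - int (c i)) + (\<Sum>i = 2..n - 1. int (l i) - int (c i))"
    unfolding range(1) by (rule sum.union_disjoint) (use range(2) in auto)
  moreover have "(\<Sum>i\<in>{1, n}. int (l i) - int (c i))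
      = (\<Sum>i\<in>{1, n}. int (l i) - \<lceil>(real (l i) + 1) / real (k i)\<rceil>)"
  proof (rule sum.cong[OF refl])
    fix i assume i: "i \<in> {1, n}"
    then have "i \<in> {1..n}" using range(1) by blast
    then show "int (l i) - int (c i) = int (l i) - \<lceil>(real (l i) + 1) / real (k i)\<rceil>"
      using int_c[of i] deg_end[OF i] by (simp add: add.commute)
  qed
  moreover have "(\<Sum>i = 2..n - 1. int (l i) - int (c i))
      = (\<Sum>i = 2..n - 1. int (l i) - \<lceil>(real (l i) + 2) / real (k i)\<rceil>)"
  proof (rule sum.cong[OF refl])
    fix i assume i: "i \<in> {2..n - 1}"
    then have "i \<in> {1..n}" using range(1) by blast
    then show "int (l i) - int (c i) = int (l i) - \<lceil>(real (l i) + 2) / real (k i)\<rceil>"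
      using int_c[of i] deg_mid[OF i] by (simp add: add.commute)
  qed
  ultimately show ?thesis by simp
qed

end
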